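(* Let $m,n$ be positive integers and let $X_1,\dots,X_m$ be nonnegative exchangeable random variables. Let $a,b\in\mathbb{Z}_{>0}^n$ be partitions of $m$ such that $a\prec_{\mathrm{maj}}b$. Define $$Y_a=\prod_{j=1}^n\left(\frac{1}{a_j}\sum_{i=A_{j-1}+1}^{A_j}X_i\right)\quad\text{and}\quad Y_b=\prod_{j=1}^n\left(\frac{1}{b_j}\sum_{i=B_{j-1}+1}^{B_j}X_i\right),$$ where $A_j=a_1+\dots+a_j$, $B_j=b_1+\dots+b_j$ and $A_0=B_0=0$. Then $Y_a\prec_{\mathrm{conv}}Y_b$.
   Context: A vector $a\in\mathbb{Z}_{>0}^n$ is a partition of $m$ if its entries sum to $m$ (the entries need not be listed in any particular order). For $a,b\in\mathbb{R}^n$, write $a\prec_{\mathrm{maj}}b$ ($b$ majorizes $a$) if $\sum_{i=1}^j a_i^{\downarrow}\le\sum_{i=1}^j b_i^{\downarrow}$ for all $j=1,\dots,n$, with equality when $j=n$, where $\downarrow$ denotes rearrangement in decreasing order. Real-valued random variables $X_1,\dots,X_m$ are exchangeable if $(X_1,\dots,X_m)$ and $(X_{\sigma(1)},\dots,X_{\sigma(m)})$ have the same distribution for every permutation $\sigma\in S_m$. For real-valued random variables $X,Y$, write $X\prec_{\mathrm{conv}}Y$ if $\mathbb{E}\,\varphi(X)\le\mathbb{E}\,\varphi(Y)$ for every convex function $\varphi:\mathbb{R}\to\mathbb{R}$. Expectations are understood as elements of $[-\infty,+\infty]$; for a nonnegative random variable $Z$ and convex $\varphi:\mathbb{R}\to\mathbb{R}$,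 the expectation $\mathbb{E}\,\varphi(Z)$ always exists in this sense, since $\varphi$ is bounded below or bounded above on $[0,\infty)$. *)

theory Defs
  imports "HOL-Probability.Probability" "HOL-Combinatorics.Permutations"
begin

text \<open>Vectors of length \<open>n\<close> are functions on \<open>nat\<close> of which only the entries
  with index in \<open>{1..n}\<close> are relevant.\<close>

definition partition_of :: "nat \<Rightarrow> nat \<Rightarrow> (nat \<Rightarrow> nat) \<Rightarrow> bool" where
  "partition_of m n a \<longleftrightarrow> (\<forall>j\<in>{1..n}. a j > 0) \<and> (\<Sum>j=1..n. a j) = m"

definition decr_rearr :: "nat \<Rightarrow> (nat \<Rightarrow> real) \<Rightarrow> nat \<Rightarrow> real" where
  "decr_rearr n x i = rev (sort (map x [1..<Suc n])) ! (i - 1)"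

definition majorized_by :: "nat \<Rightarrow> (nat \<Rightarrow> real) \<Rightarrow> (nat \<Rightarrow> real) \<Rightarrow> bool" where
  "majorized_by n x y \<longleftrightarrow>
     (\<forall>j\<in>{1..n}. (\<Sum>i=1..j. decr_rearr n x i) \<le> (\<Sum>i=1..j. decr_rearr n y i)) \<and>
     (\<Sum>i=1..n. decr_rearr n x i) = (\<Sum>i=1..n. decr_rearr n y i)"

definition exchangeable :: "'w measure \<Rightarrow> nat \<Rightarrow> (nat \<Rightarrow> 'w \<Rightarrow> real) \<Rightarrow> bool" where
  "exchangeable M m X \<longleftrightarrow>
     (\<forall>i\<in>{1..m}. X i \<in> borel_measurable M) \<and>
     (\<forall>\<sigma>. \<sigma> permutes {1..m} \<longrightarrow>
        distr M (Pi\<^sub>M {1..m} (\<lambda>_. borel)) (\<lambda>\<omega>. \<lambda>i\<in>{1..m}. X i \<omega>) =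
        distr M (Pi\<^sub>M {1..m} (\<lambda>_. borel)) (\<lambda>\<omega>. \<lambda>i\<in>{1..m}. X (\<sigma> i) \<omega>))"

text \<open>The Bochner integral is \<open>0\<close> on non-integrable functions, so expectations with values
  in \<open>[-\<infinity>, \<infinity>]\<close> are built from the positive and the negative part
  (\<open>ennreal\<close> sends negative reals to \<open>0\<close>). The value is meaningful only if one of the two
  parts has finite integral.\<close>

definition expectation_exists :: "'w measure \<Rightarrow> ('w \<Rightarrow> real) \<Rightarrow> bool" where
  "expectation_exists M f \<longleftrightarrow> f \<in> borel_measurable M \<and>
     ((\<integral>\<^sup>+\<omega>. ennreal (f \<omega>) \<partial>M) < \<infinity> \<or> (\<integral>\<^sup>+\<omega>. ennreal (- f \<omega>) \<partial>M) < \<infinity>)"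

definition ext_expectation :: "'w measure \<Rightarrow> ('w \<Rightarrow> real) \<Rightarrow> ereal" where
  "ext_expectation M f =
     enn2ereal (\<integral>\<^sup>+\<omega>. ennreal (f \<omega>) \<partial>M) - enn2ereal (\<integral>\<^sup>+\<omega>. ennreal (- f \<omega>) \<partial>M)"

lemma ext_expectation_integrable:
  assumes "integrable M f"
  shows "expectation_exists M f" "ext_expectation M f = ereal (integral\<^sup>L M f)"
proof -
  obtain r q where rq: "0 \<le> r" "0 \<le> q" "(\<integral>\<^sup>+\<omega>. ennreal (f \<omega>) \<partial>M) = ennreal r"
      "(\<integral>\<^sup>+\<omega>. ennreal (- f \<omega>) \<partial>M) = ennreal q" "integral\<^sup>L M f = r - q"
    using integrableE[OF assms] by metis
  show "expectation_exists M f"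
    using assms rq by (simp add: expectation_exists_def)
  show "ext_expectation M f = ereal (integral\<^sup>L M f)"
    using rq by (simp add: ext_expectation_def enn2ereal_ennreal)
qed

text \<open>The inequality between the expectations of \<open>\<phi> \<circ> X\<close> and \<open>\<phi> \<circ> Y\<close> is read as including
  that both of them exist.\<close>

definition conv_order :: "'w measure \<Rightarrow> ('w \<Rightarrow> real) \<Rightarrow> ('w \<Rightarrow> real) \<Rightarrow> bool" where
  "conv_order M X Y \<longleftrightarrow>
     (\<forall>\<phi>::real \<Rightarrow> real. convex_on UNIV \<phi> \<longrightarrow>
        expectation_exists M (\<lambda>\<omega>. \<phi> (X \<omega>)) \<and>
        expectation_exists M (\<lambda>\<omega>. \<phi> (Y \<omega>)) \<and>
        ext_expectation M (\<lambda>\<omega>. \<phi> (X \<omega>)) \<le> ext_expectation M (\<lambda>\<omega>. \<phi> (Y \<omega>)))"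

definition psum :: "(nat \<Rightarrow> nat) \<Rightarrow> nat \<Rightarrow> nat" where
  "psum a j = (\<Sum>k=1..j. a k)"

definition block_prod ::
  "nat \<Rightarrow> (nat \<Rightarrow> nat) \<Rightarrow> (nat \<Rightarrow> 'w \<Rightarrow> real) \<Rightarrow> 'w \<Rightarrow> real" where
  "block_prod n a X \<omega> =
     (\<Prod>j=1..n. 1 / real (a j) * (\<Sum>i = psum a (j - 1) + 1..psum a j. X i \<omega>))"

end

theory Submission
  imports Defs
begin

text \<open>
  Integrating over the permutations of the variables reduces the claim to an inequality between
  averages of \<open>\<phi> \<circ> Y\<^sub>a\<close> and \<open>\<phi> \<circ> Y\<^sub>b\<close> over all rearrangements of a fixed nonnegative vector, and by
  Muirhead's lemma one may assume that \<open>a\<close> arises from \<open>b\<close> by one unit transfer, from block sizes \<open>(q, q + r + 1)\<close> to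
  \<open>(q + 1, q + r)\<close> with \<open>r \<ge> 1\<close>.
  Split the positions of these two blocks into sets \<open>Q\<close>, \<open>Q'\<close> of size \<open>q\<close>, a single position \<open>e\<close> and a
  set \<open>R\<close> of size \<open>r\<close>, with sums \<open>S\<close>, \<open>S'\<close>, \<open>z\<close>, \<open>R\<close>. Up to constants and the factor of the other blocks,
  \<open>Y\<^sub>b\<close> takes the values \<open>B = S (S' + z + R)\<close> and \<open>B' = S' (S + z + R)\<close>, and \<open>Y\<^sub>a\<close> the values
  \<open>A = (S + z) (S' + R)\<close> and \<open>A' = (S' + z) (S + R)\<close>, the primed ones arising by exchanging \<open>Q\<close> with \<open>Q'\<close>.
  In the subgradient bound \<open>\<phi> B \<ge> \<phi> A + \<psi> A (B - A)\<close> the last \<open>A\<close> may be replaced, after averaging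
  within \<open>Q \<union> {e}\<close> and \<open>Q' \<union> R\<close>, by the multiple of \<open>S S' + S R + z S'\<close> with the same mean.
  Then \<open>A, A'\<close> can be matched with \<open>B, B'\<close> in one of the two orders so that the error terms
  become nonnegative pointwise.
\<close>

subsection \<open>Averages over permutations\<close>

lemma convex_on_subgradient:
  fixes \<phi> :: "real \<Rightarrow> real"
  assumes "convex_on UNIV \<phi>"
  obtains \<psi> where "\<And>x y. \<phi> x + \<psi> x * (y - x) \<le> \<phi> y"
proof
  fix x y
  \<comment> \<open>The witness for \<open>\<psi> x\<close> is the infimum of the slopes to the
    right of \<open>x\<close>, that is, the right derivative.\<close>
  show "\<phi> x + Inf ((\<lambda>t. (\<phi> x - \<phi> t) / (x - t)) ` ({x<..} \<inter> UNIV)) * (y - x) \<le> \<phi> y"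
    by (rule convex_le_Inf_differential[OF assms]) auto
qed

text \<open>Averages are left unnormalised, since only sums over the same permutations are
  compared.\<close>

definition perm_sum :: "'a set \<Rightarrow> ('a \<Rightarrow> real) \<Rightarrow> (('a \<Rightarrow> real) \<Rightarrow> real) \<Rightarrow> real" where
  "perm_sum U x f = (\<Sum>\<sigma> | \<sigma> permutes U. f (x \<circ> \<sigma>))"

lemma perm_sum_shift:
  assumes "\<tau> permutes U"
  shows "perm_sum U x (\<lambda>y. f (y \<circ> \<tau>)) = perm_sum U x f"
  unfolding perm_sum_def
  using sum_permutations_compose_right[OF assms, of "\<lambda>\<sigma>. f (x \<circ> \<sigma>)"] by (simp add: comp_assoc)

lemma perm_sum_add: "perm_sum U x (\<lambda>y. f y + g y) = perm_sum U x f + perm_sum U x g"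
  by (simp add: perm_sum_def sum.distrib)

lemma perm_sum_cmult: "perm_sum U x (\<lambda>y. c * f y) = c * perm_sum U x f"
  by (simp add: perm_sum_def sum_distrib_left)

lemma perm_sum_sum: "perm_sum U x (\<lambda>y. \<Sum>i\<in>I. f i y) = (\<Sum>i\<in>I. perm_sum U x (f i))"
  unfolding perm_sum_def by (rule sum.swap)

lemma perm_sum_mono:
  assumes "\<And>\<sigma>. \<sigma> permutes U \<Longrightarrow> f (x \<circ> \<sigma>) \<le> g (x \<circ> \<sigma>)"
  shows "perm_sum U x f \<le> perm_sum U x g"
  unfolding perm_sum_def by (rule sum_mono) (use assms in auto)

section \<open>Rearranging families of blocks\<close>

text \<open>Equal sizes give a bijection for each pair of blocks; these glue to one permutation
  because both families partition \<open>U\<close>.\<close>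

lemma permutes_matching_families:
  assumes fin: "finite J" "finite U"
    and A: "disjoint_family_on A J" "(\<Union>j\<in>J. A j) = U"
    and B: "disjoint_family_on B J" "(\<Union>j\<in>J. B j) = U"
    and card: "\<And>j. j \<in> J \<Longrightarrow> card (A j) = card (B j)"
  obtains \<tau> where "\<tau> permutes U" "\<And>j. j \<in> J \<Longrightarrow> bij_betw \<tau> (A j) (B j)"
proof -
  have "\<exists>f. bij_betw f (A j) (B j)" if "j \<in> J" for j
    using that card[OF that] fin(2) A(2) B(2)
    by (intro finite_same_card_bij) (auto intro: finite_subset)
  then obtain f where f: "\<And>j. j \<in> J \<Longrightarrow> bij_betw (f j) (A j) (B j)" by metis
  define \<tau> where "\<tau> i = (if i \<in> U then f (THE j. j \<in> J \<and> i \<in> A j) i else i)" for i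
  have eq: "\<tau> i = f j i" if "j \<in> J" "i \<in> A j" for i j
  proof -
    have "(THE j. j \<in> J \<and> i \<in> A j) = j"
      using that A(1) by (intro the_equality) (auto simp: disjoint_family_on_def)
    then show ?thesis using that A(2) by (auto simp: \<tau>_def)
  qed
  have bij: "bij_betw \<tau> (A j) (B j)" if "j \<in> J" for j
    using f[OF that] eq[OF that] by (simp cong: bij_betw_cong)
  have "bij_betw \<tau> U U"
    using bij_betw_UNION_disjoint[where A = A and A' = B and f = \<tau> and I = J] bij A(2) B by simp
  then have "\<tau> permutes U"
    by (rule bij_imp_permutes) (simp add: \<tau>_def)
  then show ?thesis using bij that by blast
qed

lemma sum_comp_bij_betw: "bij_betw \<tau> A B \<Longrightarrow> sum (y \<circ> \<tau>) A = sum y B"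
  using sum.reindex_bij_betw[of \<tau> A B y] by simp

lemma sum_comp_permutes:
  assumes "\<tau> permutes S" "S \<inter> A = {}"
  shows "sum (y \<circ> \<tau>) A = sum y A"
  proof (rule sum.cong)
  fix i assume "i \<in> A"
  then have "i \<notin> S" using assms(2) by blast
  then show "(y \<circ> \<tau>) i = y i" by (simp add: permutes_not_in[OF assms(1)])
qed simp

text \<open>Blocks may be arbitrary sets rather than intervals, so that a single position can be
  moved from one block to another.\<close>

definition block_means :: "'j set \<Rightarrow> ('j \<Rightarrow> 'a set) \<Rightarrow> ('a \<Rightarrow> real) \<Rightarrow> real" where
  "block_means J A y = (\<Prod>j\<in>J. sum y (A j) / real (card (A j)))"

text \<open>A permutation of \<open>U\<close> that carries each block of one family onto its
  counterpart is absorbed by \<open>perm_sum_shift\<close>; hence only the block sizes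
  matter.\<close>

lemma perm_sum_block_means_cong:
  assumes "finite J" "finite U"
    and A: "disjoint_family_on A J" "(\<Union>j\<in>J. A j) = U"
    and B: "disjoint_family_on B J" "(\<Union>j\<in>J. B j) = U"
    and card: "\<And>j. j \<in> J \<Longrightarrow> card (A j) = card (B j)"
  shows "perm_sum U x (\<lambda>y. \<phi> (block_means J A y)) = perm_sum U x (\<lambda>y. \<phi> (block_means J B y))"
proof -
  obtain \<tau> where \<tau>: "\<tau> permutes U" "\<And>j. j \<in> J \<Longrightarrow> bij_betw \<tau> (A j) (B j)"
    using permutes_matching_families[OF assms] by blast
  have "block_means J A (y \<circ> \<tau>) = block_means J B y" for y
    unfolding block_means_def using sum_comp_bij_betw[OF \<tau>(2)] card by (intro prod.cong) auto
  then show ?thesis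
    using perm_sum_shift[OF \<tau>(1), of x "\<lambda>y. \<phi> (block_means J A y)"] by simp
qed

section \<open>The inequality for a single unit transfer\<close>

text \<open>Transpositions inside \<open>D\<close> or \<open>G\<close> leave \<open>F\<close>
  unchanged, and by disjointness each moves only one factor of \<open>y i * y j\<close>. Hence all
  pairs in \<open>D \<times> G\<close> have the same weighted sum \<open>K\<close>, and a product of
  block sums merely counts pairs.\<close>

lemma perm_sum_cross_products:
  assumes fin: "finite D" "finite G" and sub: "D \<subseteq> U" "G \<subseteq> U" and disj: "D \<inter> G = {}"
    and F: "\<And>\<tau> y. \<tau> permutes D \<or> \<tau> permutes G \<Longrightarrow> F (y \<circ> \<tau>) = F y"
  obtains K where "\<And>A B. A \<subseteq> D \<Longrightarrow> B \<subseteq> G \<Longrightarrow>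
    perm_sum U x (\<lambda>y. F y * (sum y A * sum y B)) = real (card A) * real (card B) * K"
proof -
  define h where "h i j = perm_sum U x (\<lambda>y. F y * (y i * y j))" for i j
  have swap: "h i j = h (\<tau> i) (\<tau> j)" if "\<tau> permutes D \<or> \<tau> permutes G" for i j \<tau>
  proof -
    have "\<tau> permutes U" using that sub permutes_subset by blast
    from perm_sum_shift[OF this, of x "\<lambda>y. F y * (y i * y j)"] show ?thesis
      by (simp add: h_def F[OF that])
  qed
  have h: "h i j = h i' j'" if "i \<in> D" "i' \<in> D" "j \<in> G" "j' \<in> G" for i i' j j'
  proof -
    have "i \<noteq> j" "i' \<noteq> j" "i' \<noteq> j'" using that disj by auto
    have "h i j = h i' j"
      using swap[of "Transposition.transpose i i'" i j] that \<open>i \<noteq> j\<close> \<open>i' \<noteq> j\<close>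
      by (simp add: permutes_swap_id transpose_apply_other)
    also have "\<dots> = h i' j'"
      using swap[of "Transposition.transpose j j'" i' j] that \<open>i' \<noteq> j\<close> \<open>i' \<noteq> j'\<close>
      by (simp add: permutes_swap_id transpose_apply_other)
    finally show ?thesis .
  qed
  obtain K where K: "\<And>i j. i \<in> D \<Longrightarrow> j \<in> G \<Longrightarrow> h i j = K"
    using h by metis
  show ?thesis
  proof
    fix A B assume AB: "A \<subseteq> D" "B \<subseteq> G"
    have "F y * (sum y A * sum y B) = (\<Sum>i\<in>A. \<Sum>j\<in>B. F y * (y i * y j))" for y
      unfolding sum_product by (simp only: sum_distrib_left)
    then have "perm_sum U x (\<lambda>y. F y * (sum y A * sum y B)) = (\<Sum>i\<in>A. \<Sum>j\<in>B. h i j)"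
      by (simp only: h_def perm_sum_sum)
    also have "\<dots> = (\<Sum>i\<in>A. \<Sum>j\<in>B. K)"
      using AB K by (intro sum.cong) auto
    finally show "perm_sum U x (\<lambda>y. F y * (sum y A * sum y B)) = real (card A) * real (card B) * K"
      by simp
  qed
qed

text \<open>The two summands on the right are matched with \<open>u\<close> and \<open>u'\<close> in the order in which the
  subgradients \<open>\<psi> u\<close> and \<open>\<psi> u'\<close> are ordered; the excess is then a multiple of
  \<open>(\<psi> u' - \<psi> u) * (S' - S)\<close> with factor \<open>z\<close> in one case and \<open>- R\<close> in the other.\<close>

lemma convex_pairing:
  fixes c w S S' z R :: real
  assumes \<psi>: "\<And>x y. \<phi> x + \<psi> x * (y - x) \<le> \<phi> y"
    and nonneg: "0 \<le> c" "0 \<le> w" "0 \<le> z" "0 \<le> R"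
  shows "\<phi> u + \<phi> u'
      + \<psi> u * (w * (c * (S * S' + S * R + z * S')) - u)
      + \<psi> u' * (w * (c * (S * S' + S' * R + z * S)) - u')
    \<le> \<phi> (w * (c * (S * (S' + z + R)))) + \<phi> (w * (c * (S' * (S + z + R))))"
proof -
  define B B' where "B = w * (c * (S * (S' + z + R)))" and "B' = w * (c * (S' * (S + z + R)))"
  show ?thesis
  proof (cases "0 \<le> (\<psi> u' - \<psi> u) * (S' - S)")
    case True
    have "0 \<le> w * c * z * ((\<psi> u' - \<psi> u) * (S' - S))" using True nonneg by simp
    then show ?thesis
      using \<psi>[of u B] \<psi>[of u' B'] unfolding B_def B'_def by (simp add: algebra_simps)
  next
    case False
    have "0 \<le> w * c * R * ((\<psi> u - \<psi> u') * (S' - S))"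
      using False nonneg minus_mult_left[of "\<psi> u' - \<psi> u" "S' - S"]
      by (intro mult_nonneg_nonneg[of "w * c * R"]) auto
    then show ?thesis
      using \<psi>[of u B'] \<psi>[of u' B] unfolding B_def B'_def by (simp add: algebra_simps)
  qed
qed

lemma perm_sum_transfer:
  fixes x :: "'a \<Rightarrow> real"
  assumes "convex_on UNIV \<phi>"
    and U: "finite U" "Q \<subseteq> U" "Q' \<subseteq> U" "R \<subseteq> U" "e \<in> U"
    and disj: "Q \<inter> Q' = {}" "Q \<inter> R = {}" "Q' \<inter> R = {}" "e \<notin> Q" "e \<notin> Q'" "e \<notin> R"
    and card: "card Q = q" "card Q' = q" "card R = r" and q: "q \<ge> 1"
    and x: "\<And>i. i \<in> U \<Longrightarrow> 0 \<le> x i"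
    and w: "\<And>\<sigma>. \<sigma> permutes U \<Longrightarrow> 0 \<le> w (x \<circ> \<sigma>)"
    and w_inv: "\<And>\<tau> y. \<tau> permutes (insert e Q \<union> (Q' \<union> R)) \<Longrightarrow> w (y \<circ> \<tau>) = w y"
  shows "perm_sum U x (\<lambda>y. \<phi> (w y * (sum y (insert e Q) / real (q + 1) * (sum y (Q' \<union> R) / real (q + r)))))
       \<le> perm_sum U x (\<lambda>y. \<phi> (w y * (sum y Q / real q * (sum y (insert e (Q' \<union> R)) / real (q + r + 1)))))"
    (is "perm_sum U x (\<lambda>y. \<phi> (?A y)) \<le> perm_sum U x (\<lambda>y. \<phi> (?B y))")
proof -
  obtain \<psi> where \<psi>: "\<And>x y. \<phi> x + \<psi> x * (y - x) \<le> \<phi> y"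
    using convex_on_subgradient[OF assms(1)] by blast
  have fin: "finite Q" "finite Q'" "finite R"
    using U by (auto intro: finite_subset)
  define D G where "D = insert e Q" and "G = Q' \<union> R"
  have DG: "finite D" "finite G" "D \<subseteq> U" "G \<subseteq> U" "D \<inter> G = {}"
    using fin U disj by (auto simp: D_def G_def)
  \<comment> \<open>\<open>c\<close> is the normalisation of \<open>?B\<close>. Its inverse
    \<open>q * q + q * r + q\<close> also counts the pairs in the products \<open>S S'\<close>,
    \<open>S R\<close> and \<open>z S'\<close>, which is what gives \<open>H\<close> the mean of
    \<open>?A\<close>.\<close>
  define c where "c = 1 / (real q * real (q + r + 1))"
  \<comment> \<open>\<open>H\<close> has the same average as \<open>?A\<close> over the permutations within \<open>D\<close> and within \<open>G\<close>.\<close>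
  define H where "H y = w y * (c * (sum y Q * sum y Q' + sum y Q * sum y R + y e * sum y Q'))" for y

  have A_inv: "?A (y \<circ> \<tau>) = ?A y \<and> w (y \<circ> \<tau>) = w y" if "\<tau> permutes D \<or> \<tau> permutes G" for \<tau> y
  proof -
    have *: "sum (y \<circ> \<tau>) D = sum y D" "sum (y \<circ> \<tau>) G = sum y G"
      using that DG(5) sum_comp_bij_betw[OF permutes_imp_bij, of \<tau> _ y]
        sum_comp_permutes[of \<tau> D G y] sum_comp_permutes[of \<tau> G D y] by blast+
    have "\<tau> permutes (D \<union> G)" using that permutes_subset by blast
    then have "w (y \<circ> \<tau>) = w y" using w_inv by (simp add: D_def G_def)
    with * show ?thesis by (simp add: D_def G_def)
  qed
  \<comment> \<open>\<open>?A\<close> depends on \<open>y\<close> only through \<open>w\<close> and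
    the sums over \<open>D\<close> and \<open>G\<close>, so this weight is invariant as
    \<open>perm_sum_cross_products\<close> demands.\<close>
  define F where "F y = \<psi> (?A y) * w y" for y
  have F: "F (y \<circ> \<tau>) = F y" if "\<tau> permutes D \<or> \<tau> permutes G" for \<tau> y
    unfolding F_def using A_inv[OF that, of y] by metis
  obtain K where K: "\<And>A B. A \<subseteq> D \<Longrightarrow> B \<subseteq> G \<Longrightarrow>
      perm_sum U x (\<lambda>y. F y * (sum y A * sum y B)) = real (card A) * real (card B) * K"
    using perm_sum_cross_products[OF DG F] by blast
  have zero: "perm_sum U x (\<lambda>y. \<psi> (?A y) * (H y - ?A y)) = 0"
  proof -
    have split: "\<psi> (?A y) * (H y - ?A y) =
        c * (F y * (sum y Q * sum y Q')) + c * (F y * (sum y Q * sum y R))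
        + c * (F y * (sum y {e} * sum y Q'))
        + (- 1 / (real (q + 1) * real (q + r))) * (F y * (sum y D * sum y G))" for y
      using q by (simp add: F_def H_def D_def G_def field_simps)
    have K': "perm_sum U x (\<lambda>y. F y * (sum y Q * sum y Q')) = real q * real q * K"
        "perm_sum U x (\<lambda>y. F y * (sum y Q * sum y R)) = real q * real r * K"
        "perm_sum U x (\<lambda>y. F y * (sum y {e} * sum y Q')) = real q * K"
        "perm_sum U x (\<lambda>y. F y * (sum y D * sum y G)) = real (q + 1) * real (q + r) * K"
      using K[of Q Q'] K[of Q R] K[of "{e}" Q'] K[of D G] card fin disj
      by (auto simp: D_def G_def card_Un_disjoint)
    have "perm_sum U x (\<lambda>y. \<psi> (?A y) * (H y - ?A y)) =
        c * (real q * real q * K) + c * (real q * real r * K) + c * (real q * K)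
        + (- 1 / (real (q + 1) * real (q + r))) * (real (q + 1) * real (q + r) * K)"
      by (simp only: split perm_sum_add perm_sum_cmult K')
    also have "\<dots> = 0"
    proof -
      have "c * (real q * real q * K) + c * (real q * real r * K) + c * (real q * K)
          = c * (real q * real (q + r + 1)) * K" by (simp add: algebra_simps)
      also have "\<dots> = K" using q by (simp add: c_def)
      finally show ?thesis using q by simp
    qed
    finally show ?thesis .
  qed

  \<comment> \<open>The exchange of \<open>Q\<close> and \<open>Q'\<close> arises by matching a
    family indexed by \<open>bool\<close> with the same family under negated labels.\<close>
  define P where "P b = (if b then Q else Q')" for b :: bool
  have P: "disjoint_family_on P UNIV" "(\<Union>b\<in>UNIV. P b) = Q \<union> Q'"
      "disjoint_family_on (\<lambda>b. P (\<not> b)) UNIV" "(\<Union>b\<in>UNIV. P (\<not> b)) = Q \<union> Q'"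
      "\<And>b. card (P b) = card (P (\<not> b))"
    using disj card by (auto simp: P_def disjoint_family_on_def UNIV_bool)
  obtain \<tau> where \<tau>: "\<tau> permutes (Q \<union> Q')" "\<And>b. b \<in> UNIV \<Longrightarrow> bij_betw \<tau> (P b) (P (\<not> b))"
    using permutes_matching_families[OF finite[of UNIV] finite_UnI[OF fin(1,2)] P] by blast
  have \<tau>U: "\<tau> permutes U" using \<tau>(1) U permutes_subset[of \<tau> "Q \<union> Q'" U] by blast
  have \<tau>sum: "sum (y \<circ> \<tau>) Q = sum y Q'" "sum (y \<circ> \<tau>) Q' = sum y Q" for y
    using sum_comp_bij_betw[OF \<tau>(2)[of True], of y] sum_comp_bij_betw[OF \<tau>(2)[of False], of y]
    by (simp_all add: P_def)
  have \<tau>R: "sum (y \<circ> \<tau>) R = sum y R" for y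
    using disj by (intro sum_comp_permutes[OF \<tau>(1)]) auto
  have \<tau>e: "(y \<circ> \<tau>) e = y e" for y
    using permutes_not_in[OF \<tau>(1), of e] disj by simp
  have \<tau>w: "w (y \<circ> \<tau>) = w y" for y
    using \<tau>(1) permutes_subset[of \<tau> "Q \<union> Q'" "insert e Q \<union> (Q' \<union> R)"] by (intro w_inv) auto

  have sum_eR: "sum y (insert e (Q' \<union> R)) = sum y Q' + y e + sum y R" for y
    using fin disj by (simp add: sum.union_disjoint add_ac)
  have B_eq: "?B y = w y * (c * (sum y Q * (sum y Q' + y e + sum y R)))" for y
    unfolding sum_eR by (simp add: c_def)
  have B_\<tau>: "?B (y \<circ> \<tau>) = w y * (c * (sum y Q' * (sum y Q + y e + sum y R)))" for y
    using B_eq[of "y \<circ> \<tau>"] unfolding \<tau>sum \<tau>R \<tau>e \<tau>w .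
  have H_\<tau>: "H (y \<circ> \<tau>) = w y * (c * (sum y Q * sum y Q' + sum y Q' * sum y R + y e * sum y Q))" for y
    unfolding H_def \<tau>sum \<tau>R \<tau>e \<tau>w by (simp add: mult.commute)
  have pointwise: "\<phi> (?A y) + \<phi> (?A (y \<circ> \<tau>)) + \<psi> (?A y) * (H y - ?A y)
        + \<psi> (?A (y \<circ> \<tau>)) * (H (y \<circ> \<tau>) - ?A (y \<circ> \<tau>)) \<le> \<phi> (?B y) + \<phi> (?B (y \<circ> \<tau>))"
    if "y = x \<circ> \<sigma>" "\<sigma> permutes U" for y \<sigma>
  proof -
    have "0 \<le> y i" if "i \<in> U" for i
      using that \<open>y = x \<circ> \<sigma>\<close> x permutes_in_image[OF \<open>\<sigma> permutes U\<close>] by simp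
    then have "0 \<le> y e" "0 \<le> sum y R" using U by (blast intro: sum_nonneg)+
    moreover have "0 \<le> w y" using w that by simp
    moreover have "0 \<le> c" by (simp add: c_def)
    ultimately show ?thesis
      unfolding B_eq[of y] B_\<tau> H_def[of y] H_\<tau> by (intro convex_pairing[OF \<psi>])
  qed
  \<comment> \<open>Under the sum each term at \<open>y \<circ> \<tau>\<close> equals its partner at
    \<open>y\<close>, so the \<open>\<phi>\<close> terms double and the error terms vanish by
    \<open>zero\<close>.\<close>
  have "perm_sum U x (\<lambda>y. \<phi> (?A y) + \<phi> (?A (y \<circ> \<tau>)) + \<psi> (?A y) * (H y - ?A y)
        + \<psi> (?A (y \<circ> \<tau>)) * (H (y \<circ> \<tau>) - ?A (y \<circ> \<tau>)))
      \<le> perm_sum U x (\<lambda>y. \<phi> (?B y) + \<phi> (?B (y \<circ> \<tau>)))"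
    using pointwise by (intro perm_sum_mono) blast
  then show ?thesis
    using perm_sum_shift[OF \<tau>U, of x "\<lambda>y. \<phi> (?A y)"] perm_sum_shift[OF \<tau>U, of x "\<lambda>y. \<phi> (?B y)"]
      perm_sum_shift[OF \<tau>U, of x "\<lambda>y. \<psi> (?A y) * (H y - ?A y)"] zero
    unfolding perm_sum_add by linarith
qed

subsection \<open>Majorization of integer vectors\<close>

lemma psum_0 [simp]: "psum c 0 = 0" by (simp add: psum_def)
lemma psum_Suc [simp]: "psum c (Suc t) = psum c t + c (Suc t)" by (simp add: psum_def)

text \<open>Only the prefixes that contain \<open>i\<close> but not \<open>j\<close> lose a unit.
  The additive form avoids truncated subtraction.\<close>

lemma psum_unit_transfer:
  assumes "1 \<le> i" "i < j" "c i \<ge> 1"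
  shows "psum (c(i := c i - 1, j := c j + 1)) t + (if i \<le> t \<and> t < j then 1 else 0) = psum c t"
proof (induction t)
  case 0
  then show ?case using assms by simp
next
  case (Suc t)
  then show ?case using assms by (auto split: if_splits)
qed

text \<open>Muirhead's lemma as an induction rule. The unit transfer goes from the last \<open>i\<close> with \<open>a i < b i\<close>
  before the first \<open>j\<close> with \<open>b j < a j\<close>, which keeps \<open>b\<close> decreasing.\<close>

lemma majorization_transfer_induct:
  fixes \<Psi> :: "(nat \<Rightarrow> nat) \<Rightarrow> real"
  assumes cong: "\<And>c d. (\<And>k. k \<in> {1..n} \<Longrightarrow> c k = d k) \<Longrightarrow> \<Psi> c = \<Psi> d"
    and transfer: "\<And>c i j. \<lbrakk>i \<in> {1..n}; j \<in> {1..n}; \<And>k. k \<in> {1..n} \<Longrightarrow> c k > 0; psum c n = m;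
        c i \<ge> c j + 2\<rbrakk> \<Longrightarrow> \<Psi> (c(i := c i - 1, j := c j + 1)) \<le> \<Psi> c"
    and a_decr: "\<And>i j. 1 \<le> i \<Longrightarrow> i \<le> j \<Longrightarrow> j \<le> n \<Longrightarrow> a j \<le> a i"
    and a: "psum a n = m"
    and "\<And>i j. 1 \<le> i \<Longrightarrow> i \<le> j \<Longrightarrow> j \<le> n \<Longrightarrow> b j \<le> b i"
    and "\<And>k. k \<in> {1..n} \<Longrightarrow> b k > 0" "psum b n = m"
    and "\<And>j. j \<le> n \<Longrightarrow> psum a j \<le> psum b j"
  shows "\<Psi> a \<le> \<Psi> b"
  using assms(5-8)
\<comment> \<open>The measure is the total gap between the prefix sums; subtraction on
  \<open>nat\<close> is harmless because \<open>psum a\<close> stays below \<open>psum b\<close>. A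
  transfer from \<open>i\<close> to \<open>j\<close> lowers it by \<open>j - i\<close>.\<close>
proof (induction "\<Sum>j\<le>n. psum b j - psum a j" arbitrary: b rule: less_induct)
  case less
  note b_decr = less.prems(1) and b_pos = less.prems(2) and b = less.prems(3) and le = less.prems(4)
  show ?case
  proof (cases "\<exists>l\<in>{1..n}. b l < a l")
    \<comment> \<open>Here \<open>b\<close> dominates \<open>a\<close> entrywise, and equal totals
      force equality on \<open>{1..n}\<close>.\<close>
    case False
    then have ge: "a k \<le> b k" if "k \<in> {1..n}" for k using that by (meson not_less)
    have "a k = b k" if "k \<in> {1..n}" for k
    proof (rule ccontr)
      assume "a k \<noteq> b k"
      then have "psum a n < psum b n"
        unfolding psum_def using ge that \<open>a k \<noteq> b k\<close> by (intro sum_strict_mono_ex1) (auto intro!: bexI[of _ k] simp: le_neq_implies_less)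
      then show False using a b by simp
    qed
    then show ?thesis using cong[of a b] by simp
  next
    case True
    define j where "j = (LEAST l. l \<in> {1..n} \<and> b l < a l)"
    have j: "j \<in> {1..n}" "b j < a j"
      using True LeastI_ex[of "\<lambda>l. l \<in> {1..n} \<and> b l < a l"] unfolding j_def by blast+
    have before_j: "a l \<le> b l" if "1 \<le> l" "l < j" for l
      using that j not_less_Least[of l "\<lambda>l. l \<in> {1..n} \<and> b l < a l"] unfolding j_def[symmetric] by force
    \<comment> \<open>Otherwise \<open>a\<close> and \<open>b\<close> agree before \<open>j\<close>,
      and the prefix sum of \<open>a\<close> up to \<open>j\<close> exceeds that of
      \<open>b\<close>.\<close>
    have "\<exists>i. 1 \<le> i \<and> i < j \<and> a i < b i"
    proof (rule ccontr)
      assume "\<not> ?thesis"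
      then have "a l = b l" if "1 \<le> l" "l < j" for l using before_j[OF that] that by (meson le_neq_implies_less)
      then have "psum a (j - 1) = psum b (j - 1)" unfolding psum_def by (intro sum.cong) auto
      moreover have "psum c j = psum c (j - 1) + c j" for c using j psum_Suc[of c "j - 1"] by simp
      ultimately show False using j le[of j] by simp
    qed
    define i where "i = (GREATEST i. 1 \<le> i \<and> i < j \<and> a i < b i)"
    have i: "1 \<le> i" "i < j" "a i < b i"
      using GreatestI_ex_nat[of "\<lambda>i. 1 \<le> i \<and> i < j \<and> a i < b i" j] \<open>\<exists>i. _\<close> unfolding i_def by auto
    have between: "a l = b l" if "i < l" "l < j" for l
    proof (rule ccontr)
      assume "a l \<noteq> b l"
      then have "1 \<le> l \<and> l < j \<and> a l < b l" using before_j[of l] that i by auto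
      then have "l \<le> i" unfolding i_def by (intro Greatest_le_nat[of _ _ j]) auto
      then show False using that by simp
    qed
    \<comment> \<open>The chain \<open>b j < a j \<le> a i < b i\<close> yields the difference of
      2.\<close>
    have gap: "b i \<ge> b j + 2" using i j a_decr[of i j] by auto
    define b' where "b' = b(i := b i - 1, j := b j + 1)"
    have psum_b': "psum b' t + (if i \<le> t \<and> t < j then 1 else 0) = psum b t" for t
      unfolding b'_def using i gap by (intro psum_unit_transfer) auto
    \<comment> \<open>The surplus gained at \<open>i\<close> persists until \<open>j\<close> because
      the entries in between agree, so these prefix sums of \<open>b\<close> can afford to lose a
      unit.\<close>
    have strict: "psum a t < psum b t" if "i \<le> t" "t < j" for t
      using that
    proof (induction t rule: dec_induct)
      case base
      have "psum c i = psum c (i - 1) + c i" for c using i psum_Suc[of c "i - 1"] by simp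
      moreover have "i - 1 \<le> n" using i j by auto
      ultimately show ?case using i j le[of "i - 1"] by simp
    next
      case (step t)
      then show ?case using between[of "Suc t"] by simp
    qed
    have le': "psum a t \<le> psum b' t" if "t \<le> n" for t
      using le[OF that] psum_b'[of t] strict[of t] by (auto split: if_splits)
    \<comment> \<open>Entries strictly between \<open>i\<close> and \<open>j\<close> equal those of
      \<open>a\<close>, hence are at most \<open>a i \<le> b i - 1\<close>; entries before
      \<open>j\<close> are at least \<open>a j \<ge> b j + 1\<close>.\<close>
    have b'_decr: "b' l \<le> b' k" if "1 \<le> k" "k \<le> l" "l \<le> n" for k l
    proof -
      have 1: "b l \<le> a i" if "i < l" "l < j" using between[of l] that a_decr[of i l] i j by auto
      have 2: "a j \<le> b k" if "1 \<le> k" "k < j" using before_j[of k] that a_decr[of k j] j by auto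
      show ?thesis
        using that 1 2 b_decr[of k l] b_decr[of j l] i j gap unfolding b'_def
        by (cases "l < j") (auto split: if_splits)
    qed
    have b'_pos: "b' k > 0" if "k \<in> {1..n}" for k
      using b_pos[OF that] gap by (auto simp: b'_def)
    have "psum b' n = m" using psum_b'[of n] b j by simp
    moreover have "(\<Sum>t\<le>n. psum b' t - psum a t) < (\<Sum>t\<le>n. psum b t - psum a t)"
    proof (rule sum_strict_mono_ex1)
      show "\<forall>t\<in>{..n}. psum b' t - psum a t \<le> psum b t - psum a t"
        using psum_b' by (metis diff_le_mono le_add1)
      have "psum b' i - psum a i < psum b i - psum a i"
        using psum_b'[of i] le'[of i] i j by simp
      then show "\<exists>t\<in>{..n}. psum b' t - psum a t < psum b t - psum a t"
        using i j by (intro bexI[of _ i]) auto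
    qed simp
    ultimately have "\<Psi> a \<le> \<Psi> b'"
      using less.hyps[of b'] b'_decr b'_pos le' by blast
    also have "\<Psi> b' \<le> \<Psi> b"
      unfolding b'_def using i j b_pos b gap by (intro transfer) auto
    finally show ?thesis .
  qed
qed

section \<open>Consecutive blocks\<close>

lemma psum_mono: "i \<le> j \<Longrightarrow> psum c i \<le> psum c j"
  unfolding psum_def by (rule sum_mono2) auto

definition consec_block :: "(nat \<Rightarrow> nat) \<Rightarrow> nat \<Rightarrow> nat set" where
  "consec_block c j = {psum c (j - 1) + 1..psum c j}"

lemma card_consec_block: "1 \<le> j \<Longrightarrow> card (consec_block c j) = c j"
  using psum_Suc[of c "j - 1"] by (simp add: consec_block_def)

lemma disjoint_consec_block: "disjoint_family_on (consec_block c) {1..n}"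
proof -
  have "consec_block c i \<inter> consec_block c j = {}" if "i < j" for i j
  proof -
    have "psum c i \<le> psum c (j - 1)" using that by (intro psum_mono) auto
    then show ?thesis by (auto simp: consec_block_def)
  qed
  then show ?thesis
    unfolding disjoint_family_on_def by (metis Int_commute linorder_neqE_nat)
qed

lemma UN_consec_block: "(\<Union>j\<in>{1..n}. consec_block c j) = {1..psum c n}"
proof (induction n)
  case (Suc n)
  have "(\<Union>j\<in>{1..Suc n}. consec_block c j) = {1..psum c n} \<union> consec_block c (Suc n)"
    using Suc by (simp only: atLeastAtMostSuc_conv[of 1 n] le_add1 plus_1_eq_Suc UN_insert Un_commute)
  also have "\<dots> = {1..psum c (Suc n)}" by (auto simp: consec_block_def)
  finally show ?case .
qed simp

text \<open>Block \<open>j\<close> serves as \<open>Q\<close>, and block \<open>i\<close> splits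
  into \<open>Q'\<close>, \<open>e\<close> and \<open>R\<close>. Moving \<open>e\<close> to block
  \<open>j\<close> gives blocks of sizes \<open>c'\<close> that need not be intervals;
  \<open>perm_sum_block_means_cong\<close> replaces them by intervals of the same sizes.\<close>

lemma block_means_consec_transfer:
  fixes x :: "nat \<Rightarrow> real"
  assumes \<phi>: "convex_on UNIV \<phi>"
    and x: "\<And>i. i \<in> {1..m} \<Longrightarrow> 0 \<le> x i"
    and ij: "i \<in> {1..n}" "j \<in> {1..n}" and pos: "\<And>k. k \<in> {1..n} \<Longrightarrow> c k > 0"
    and m: "psum c n = m" and gap: "c i \<ge> c j + 2"
  defines "c' \<equiv> c(i := c i - 1, j := c j + 1)"
  shows "perm_sum {1..m} x (\<lambda>y. \<phi> (block_means {1..n} (consec_block c') y))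
       \<le> perm_sum {1..m} x (\<lambda>y. \<phi> (block_means {1..n} (consec_block c) y))"
proof -
  define A where "A = consec_block c"
  define U J where "U = {1..m}" and "J = {1..n} - {i, j}"
  have A: "disjoint_family_on A {1..n}" "(\<Union>k\<in>{1..n}. A k) = U"
    and card_A: "\<And>k. k \<in> {1..n} \<Longrightarrow> card (A k) = c k"
    using disjoint_consec_block UN_consec_block m card_consec_block by (auto simp: A_def U_def)
  have sub: "A k \<subseteq> U" if "k \<in> {1..n}" for k using A(2) that by blast
  have finA: "finite (A k)" for k by (simp add: A_def consec_block_def)
  have "i \<noteq> j" using gap by auto
  then have J: "{1..n} = insert i (insert j J)" "i \<notin> J" "j \<notin> J" "finite J" "i \<noteq> j"
    using ij by (auto simp: J_def)
  have disjA: "A k \<inter> A l = {}" if "k \<in> {1..n}" "l \<in> {1..n}" "k \<noteq> l" for k l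
    using A(1) that by (auto simp: disjoint_family_on_def)
  \<comment> \<open>The gap leaves positions of \<open>A i\<close> outside \<open>Q'\<close>; one of
    them is the position \<open>e\<close> to be moved.\<close>
  obtain Q' where Q': "Q' \<subseteq> A i" "card Q' = c j" "finite Q'"
    using obtain_subset_with_card_n[of "c j" "A i"] card_A[OF ij(1)] gap by auto
  have "card (A i - Q') \<noteq> 0" using Q' card_A[OF ij(1)] gap by (simp add: card_Diff_subset)
  then obtain e where e: "e \<in> A i" "e \<notin> Q'" by (metis card.empty Diff_iff equals0I)
  define R where "R = A i - Q' - {e}"
  define r where "r = card R"
  have Ai: "A i = insert e (Q' \<union> R)" "e \<notin> Q' \<union> R" "Q' \<inter> R = {}" "finite R"
    using Q' e finA by (auto simp: R_def)
  have ci: "c i = c j + r + 1"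
    using card_A[OF ij(1)] Ai Q' by (simp add: r_def card_Un_disjoint)
  define A' where "A' = A(i := Q' \<union> R, j := insert e (A j))"
  have Aj: "A j \<inter> A i = {}" using disjA ij J by blast
  have card_A': "card (A' k) = c' k" if "k \<in> {1..n}" for k
    using card_A[OF that] card_A[OF ij(2)] ci Ai Aj Q' finA J
    by (auto simp: A'_def c'_def r_def card_Un_disjoint)
  have dis': "disjoint_family_on A' {1..n}"
  proof -
    have "A i \<inter> A k = {} \<and> A k \<inter> A i = {} \<and> A j \<inter> A k = {} \<and> A k \<inter> A j = {}" if "k \<in> J" for k
      using that disjA ij J by blast
    moreover have "A k \<inter> A l = {}" if "k \<in> J" "l \<in> J" "k \<noteq> l" for k l
      using that disjA J by blast
    ultimately show ?thesis
      unfolding J(1) disjoint_family_on_def A'_def using Ai Aj J by auto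
  qed
  have un': "(\<Union>k\<in>{1..n}. A' k) = U"
    using A(2) J(2,3,5) unfolding J(1) by (auto simp: A'_def Ai(1))
  have psum': "psum c' n = m"
  proof -
    have "psum c n = c i + (c j + sum c J)" unfolding psum_def J(1) using J by simp
    moreover have "psum c' n = c' i + (c' j + sum c' J)" unfolding psum_def J(1) using J by simp
    moreover have "sum c' J = sum c J" using J by (intro sum.cong) (auto simp: c'_def)
    ultimately show ?thesis using m gap J by (simp add: c'_def)
  qed
  \<comment> \<open>The untouched blocks are disjoint from \<open>A i \<union> A j\<close>, so their
    product is invariant under permutations of that union.\<close>
  define w where "w y = (\<Prod>k\<in>J. sum y (A k) / real (c k))" for y
  have subs: "Q' \<subseteq> U" "R \<subseteq> U" "e \<in> U" "A j \<subseteq> U" using sub[OF ij(1)] sub[OF ij(2)] Ai(1) by auto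
  have "perm_sum U x (\<lambda>y. \<phi> (w y * (sum y (insert e (A j)) / real (c j + 1) * (sum y (Q' \<union> R) / real (c j + r)))))
      \<le> perm_sum U x (\<lambda>y. \<phi> (w y * (sum y (A j) / real (c j) * (sum y (insert e (Q' \<union> R)) / real (c j + r + 1)))))"
  proof (rule perm_sum_transfer[OF \<phi>])
    show "0 \<le> w (x \<circ> \<sigma>)" if "\<sigma> permutes U" for \<sigma>
    proof -
      have "0 \<le> (x \<circ> \<sigma>) l" if "l \<in> U" for l
        using x permutes_in_image[OF \<open>\<sigma> permutes U\<close>, of l] that by (simp add: U_def)
      moreover have "A k \<subseteq> U" if "k \<in> J" for k using that sub unfolding J(1) by blast
      ultimately show ?thesis unfolding w_def
        by (intro prod_nonneg divide_nonneg_nonneg sum_nonneg ballI) auto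
    qed
    show "w (y \<circ> \<tau>) = w y" if "\<tau> permutes insert e (A j) \<union> (Q' \<union> R)" for \<tau> y
    proof -
      have "insert e (A j) \<union> (Q' \<union> R) = A i \<union> A j" using Ai by auto
      moreover have "(A i \<union> A j) \<inter> A k = {}" if "k \<in> J" for k
        using that disjA ij J by blast
      ultimately have "sum (y \<circ> \<tau>) (A k) = sum y (A k)" if "k \<in> J" for k
        using that \<open>\<tau> permutes _\<close> by (intro sum_comp_permutes) auto
      then show ?thesis unfolding w_def by (intro prod.cong) auto
    qed
    show "\<And>k. k \<in> U \<Longrightarrow> 0 \<le> x k" using x by (simp add: U_def)
    show "finite U" by (simp add: U_def)
  qed (use subs Ai Aj Q' e ij card_A pos[OF ij(2)] in \<open>auto simp: r_def Suc_le_eq\<close>)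
  also have "(\<lambda>y. \<phi> (w y * (sum y (A j) / real (c j) * (sum y (insert e (Q' \<union> R)) / real (c j + r + 1)))))
      = (\<lambda>y. \<phi> (block_means {1..n} A y))"
  proof -
    have "block_means {1..n} A y = w y * (sum y (A j) / real (c j) * (sum y (A i) / real (c i)))" for y
      unfolding block_means_def w_def using J card_A by (simp add: mult_ac)
    then show ?thesis using Ai(1) ci by simp
  qed
  also have "(\<lambda>y. \<phi> (w y * (sum y (insert e (A j)) / real (c j + 1) * (sum y (Q' \<union> R) / real (c j + r)))))
      = (\<lambda>y. \<phi> (block_means {1..n} A' y))"
  proof -
    have "block_means {1..n} A' y = (\<Prod>k\<in>{1..n}. sum y (A' k) / real (c' k))" for y
      unfolding block_means_def using card_A' by (intro prod.cong) auto
    moreover have "(\<Prod>k\<in>J. sum y (A' k) / real (c' k)) = w y" for y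
      unfolding w_def using J by (intro prod.cong) (auto simp: A'_def c'_def)
    ultimately have "block_means {1..n} A' y = w y * (sum y (A' j) / real (c' j) * (sum y (A' i) / real (c' i)))" for y
      using J by (simp add: mult_ac)
    then show ?thesis using J ci by (simp add: A'_def c'_def add.commute)
  qed
  also have "perm_sum U x (\<lambda>y. \<phi> (block_means {1..n} A' y))
      = perm_sum U x (\<lambda>y. \<phi> (block_means {1..n} (consec_block c') y))"
    using dis' un' card_A' disjoint_consec_block UN_consec_block card_consec_block psum'
    by (intro perm_sum_block_means_cong) (auto simp: U_def)
  finally show ?thesis by (simp add: A_def U_def)
qed

text \<open>The consecutive blocks of \<open>c \<circ> \<pi>\<close> have the sizes of the
  relabelled blocks of \<open>c\<close>, and relabelling the factors does not change a product. This
  permits passing to sorted vectors.\<close>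

lemma perm_sum_block_means_permute:
  assumes "\<pi> permutes {1..n}" "psum c n = m"
  shows "perm_sum {1..m} x (\<lambda>y. \<phi> (block_means {1..n} (consec_block (c \<circ> \<pi>)) y))
       = perm_sum {1..m} x (\<lambda>y. \<phi> (block_means {1..n} (consec_block c) y))"
proof -
  have in_image: "\<pi> k \<in> {1..n} \<longleftrightarrow> k \<in> {1..n}" for k using permutes_in_image[OF assms(1)] .
  then have pos: "1 \<le> \<pi> k" if "k \<in> {1..n}" for k using that by (meson atLeastAtMost_iff)
  define c' where "c' = c \<circ> \<pi>"
  have card': "card (consec_block c' k) = card (consec_block c (\<pi> k))" if "k \<in> {1..n}" for k
    using that pos[OF that] by (simp add: card_consec_block c'_def)
  have "psum c' n = m"
    using assms(2) sum.permute[OF assms(1), of c] by (simp add: psum_def c'_def)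
  moreover have "disjoint_family_on (\<lambda>k. consec_block c (\<pi> k)) {1..n}"
    unfolding disjoint_family_on_def
    using disjoint_consec_block[of c n] in_image permutes_inj[OF assms(1)]
    by (metis disjoint_family_on_def injD)
  moreover have "(\<Union>k\<in>{1..n}. consec_block c (\<pi> k)) = {1..m}"
    using UN_consec_block[of c n] permutes_image[OF assms(1)] assms(2) by (metis image_image)
  ultimately have "perm_sum {1..m} x (\<lambda>y. \<phi> (block_means {1..n} (consec_block c') y))
      = perm_sum {1..m} x (\<lambda>y. \<phi> (block_means {1..n} (\<lambda>k. consec_block c (\<pi> k)) y))"
    using disjoint_consec_block UN_consec_block card'
    by (intro perm_sum_block_means_cong) auto
  also have "\<dots> = perm_sum {1..m} x (\<lambda>y. \<phi> (block_means {1..n} (consec_block c) y))"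
  proof -
    have "block_means {1..n} (\<lambda>k. consec_block c (\<pi> k)) y = block_means {1..n} (consec_block c) y" for y
      unfolding block_means_def
      by (subst (2) prod.permute[OF assms(1)]) (simp add: o_def)
    then show ?thesis by simp
  qed
  finally show ?thesis by (simp add: c'_def)
qed

section \<open>Sorting, and the averaged inequality under majorization\<close>

text \<open>Sorting keeps the multiset of entries, and two functions on \<open>{1..n}\<close> with
  the same multiset of values differ by a permutation of the domain.\<close>

lemma decr_rearr_permutation:
  obtains \<pi> where "\<pi> permutes {1..n}" "\<And>i. i \<in> {1..n} \<Longrightarrow> decr_rearr n x i = x (\<pi> i)"
proof -
  let ?L = "rev (sort (map x [1..<Suc n]))"
  have "map (decr_rearr n x) [1..<Suc n] = ?L"
    by (rule nth_equalityI) (auto simp: decr_rearr_def simp del: upt_Suc)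
  then have "mset (map (decr_rearr n x) [1..<Suc n]) = mset (map x [1..<Suc n])"
    by simp
  moreover have "mset_set {1..n} = mset [1..<Suc n]"
    by (metis atLeastLessThanSuc_atLeastAtMost mset_upt)
  ultimately have eq: "image_mset (decr_rearr n x) (mset_set {1..n}) = image_mset x (mset_set {1..n})"
    by (simp only: mset_map)
  obtain p where p: "p permutes {1..n}" "\<forall>i\<in>{1..n}. decr_rearr n x i = x (p i)"
    by (rule image_mset_eq_implies_permutes[OF finite_atLeastAtMost eq])
  show ?thesis by (rule that[OF p(1)]) (rule bspec[OF p(2)])
qed

lemma decr_rearr_antimono:
  assumes "1 \<le> i" "i \<le> j" "j \<le> n"
  shows "decr_rearr n x j \<le> decr_rearr n x i"
  unfolding decr_rearr_def
  using assms by (intro sorted_rev_nth_mono) auto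

text \<open>Muirhead's induction connects the decreasing vectors \<open>a \<circ> \<alpha>\<close>
  and \<open>b \<circ> \<beta>\<close>; \<open>perm_sum_block_means_permute\<close> then undoes the
  sorting on both sides.\<close>

lemma perm_sum_majorization:
  assumes \<phi>: "convex_on UNIV \<phi>"
    and x: "\<And>i. i \<in> {1..m} \<Longrightarrow> 0 \<le> x i"
    and a: "partition_of m n a" and b: "partition_of m n b"
    and maj: "majorized_by n (\<lambda>j. real (a j)) (\<lambda>j. real (b j))"
  shows "perm_sum {1..m} x (\<lambda>y. \<phi> (block_means {1..n} (consec_block a) y))
       \<le> perm_sum {1..m} x (\<lambda>y. \<phi> (block_means {1..n} (consec_block b) y))"
proof -
  define \<Psi> where "\<Psi> c = perm_sum {1..m} x (\<lambda>y. \<phi> (block_means {1..n} (consec_block c) y))" for c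
  obtain \<alpha> where \<alpha>: "\<alpha> permutes {1..n}"
      "\<And>i. i \<in> {1..n} \<Longrightarrow> decr_rearr n (\<lambda>j. real (a j)) i = real (a (\<alpha> i))"
    by (rule decr_rearr_permutation[of n "\<lambda>j. real (a j)"]) (rule that)
  obtain \<beta> where \<beta>: "\<beta> permutes {1..n}"
      "\<And>i. i \<in> {1..n} \<Longrightarrow> decr_rearr n (\<lambda>j. real (b j)) i = real (b (\<beta> i))"
    by (rule decr_rearr_permutation[of n "\<lambda>j. real (b j)"]) (rule that)
  have psum: "psum a n = m" "psum b n = m"
    using a b by (auto simp: partition_of_def psum_def)
  then have psum': "psum (a \<circ> \<alpha>) n = m" "psum (b \<circ> \<beta>) n = m"
    using sum.permute[OF \<alpha>(1), of a] sum.permute[OF \<beta>(1), of b] by (simp_all add: psum_def)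
  have "\<Psi> (a \<circ> \<alpha>) \<le> \<Psi> (b \<circ> \<beta>)"
  proof (rule majorization_transfer_induct[where n = n and m = m and a = "a \<circ> \<alpha>" and b = "b \<circ> \<beta>" and \<Psi> = \<Psi>])
    fix c d :: "nat \<Rightarrow> nat" assume cd: "\<And>k. k \<in> {1..n} \<Longrightarrow> c k = d k"
    have "psum c k = psum d k" if "k \<le> n" for k
      unfolding psum_def using cd that by (intro sum.cong) auto
    then have "block_means {1..n} (consec_block c) = block_means {1..n} (consec_block d)"
      by (intro ext) (auto simp: block_means_def consec_block_def intro!: prod.cong)
    then show "\<Psi> c = \<Psi> d" by (simp add: \<Psi>_def)
  next
    fix c i j
    assume "i \<in> {1..n}" "j \<in> {1..n}" "\<And>k. k \<in> {1..n} \<Longrightarrow> c k > 0" "psum c n = m" "c i \<ge> c j + 2"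
    then show "\<Psi> (c(i := c i - 1, j := c j + 1)) \<le> \<Psi> c"
      unfolding \<Psi>_def using \<phi> x by (intro block_means_consec_transfer) auto
  next
    fix i j assume "1 \<le> i" "i \<le> j" "j \<le> n"
    then show "(a \<circ> \<alpha>) j \<le> (a \<circ> \<alpha>) i" "(b \<circ> \<beta>) j \<le> (b \<circ> \<beta>) i"
      using decr_rearr_antimono[of i j n "\<lambda>j. real (a j)"] decr_rearr_antimono[of i j n "\<lambda>j. real (b j)"]
        \<alpha>(2) \<beta>(2) by auto
  next
    fix k assume "k \<in> {1..n}"
    then show "(b \<circ> \<beta>) k > 0"
      using b permutes_in_image[OF \<beta>(1), of k] by (simp add: partition_of_def)
  next
    fix j assume "j \<le> n"
    then have "(\<Sum>i=1..j. decr_rearr n (\<lambda>j. real (a j)) i) \<le> (\<Sum>i=1..j. decr_rearr n (\<lambda>j. real (b j)) i)"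
      \<comment> \<open>\<open>majorized_by\<close> starts at \<open>j = 1\<close>; for
        \<open>j = 0\<close> both sums are empty.\<close>
      using maj by (cases "j = 0") (auto simp: majorized_by_def)
    also have "(\<Sum>i=1..j. decr_rearr n (\<lambda>j. real (a j)) i) = real (psum (a \<circ> \<alpha>) j)"
      unfolding psum_def of_nat_sum using \<alpha>(2) \<open>j \<le> n\<close> by (intro sum.cong) auto
    also have "(\<Sum>i=1..j. decr_rearr n (\<lambda>j. real (b j)) i) = real (psum (b \<circ> \<beta>) j)"
      unfolding psum_def of_nat_sum using \<beta>(2) \<open>j \<le> n\<close> by (intro sum.cong) auto
    finally show "psum (a \<circ> \<alpha>) j \<le> psum (b \<circ> \<beta>) j" by simp
  qed (use psum' in auto)
  then show ?thesis
    using perm_sum_block_means_permute[OF \<alpha>(1) psum(1), of x \<phi>]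
      perm_sum_block_means_permute[OF \<beta>(1) psum(2), of x \<phi>]
    by (simp add: \<Psi>_def)
qed

subsection \<open>Exchangeable variables and extended expectations\<close>

lemma exchangeable_nn_integral:
  fixes G :: "(nat \<Rightarrow> real) \<Rightarrow> ennreal"
  assumes "exchangeable M m X" "\<sigma> permutes {1..m}"
    and G: "G \<in> borel_measurable (Pi\<^sub>M {1..m} (\<lambda>_. borel))"
  shows "(\<integral>\<^sup>+\<omega>. G (\<lambda>i\<in>{1..m}. X (\<sigma> i) \<omega>) \<partial>M) = (\<integral>\<^sup>+\<omega>. G (\<lambda>i\<in>{1..m}. X i \<omega>) \<partial>M)"
proof -
  have X: "X i \<in> borel_measurable M" if "i \<in> {1..m}" for i
    using assms(1) that by (simp add: exchangeable_def)
  have 1: "(\<lambda>\<omega>. \<lambda>i\<in>{1..m}. X i \<omega>) \<in> measurable M (Pi\<^sub>M {1..m} (\<lambda>_. borel))"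
    using X by (intro measurable_restrict) auto
  have 2: "(\<lambda>\<omega>. \<lambda>i\<in>{1..m}. X (\<sigma> i) \<omega>) \<in> measurable M (Pi\<^sub>M {1..m} (\<lambda>_. borel))"
    using X permutes_in_image[OF assms(2)] by (intro measurable_restrict) blast
  have "distr M (Pi\<^sub>M {1..m} (\<lambda>_. borel)) (\<lambda>\<omega>. \<lambda>i\<in>{1..m}. X i \<omega>) =
        distr M (Pi\<^sub>M {1..m} (\<lambda>_. borel)) (\<lambda>\<omega>. \<lambda>i\<in>{1..m}. X (\<sigma> i) \<omega>)"
    using assms(1,2) by (simp add: exchangeable_def)
  then show ?thesis
    using nn_integral_distr[OF 1, of G] nn_integral_distr[OF 2, of G] G by simp
qed

text \<open>By exchangeability all \<open>fact m\<close> rearrangements have the same integral.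
  \<open>local\<close> links total functions to the product space, whose points are restricted to
  \<open>{1..m}\<close>; nonnegativity lets \<open>ennreal\<close> commute with the sum.\<close>

lemma exchangeable_nn_integral_perm_sum:
  fixes G :: "(nat \<Rightarrow> real) \<Rightarrow> real"
  assumes ex: "exchangeable M m X"
    and nonneg: "AE \<omega> in M. \<forall>i\<in>{1..m}. X i \<omega> \<ge> 0"
    and meas: "G \<in> borel_measurable (Pi\<^sub>M {1..m} (\<lambda>_. borel))"
    and local: "\<And>x. G (restrict x {1..m}) = G x"
    and G: "\<And>x. (\<forall>i\<in>{1..m}. 0 \<le> x i) \<Longrightarrow> 0 \<le> G x"
  shows "fact m * (\<integral>\<^sup>+\<omega>. ennreal (G (\<lambda>i. X i \<omega>)) \<partial>M)
       = (\<integral>\<^sup>+\<omega>. ennreal (perm_sum {1..m} (\<lambda>i. X i \<omega>) G) \<partial>M)"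
proof -
  let ?P = "{\<sigma>. \<sigma> permutes {1..m}}"
  have X: "X i \<in> borel_measurable M" if "i \<in> {1..m}" for i
    using ex that by (simp add: exchangeable_def)
  have measG: "(\<lambda>x. ennreal (G x)) \<in> borel_measurable (Pi\<^sub>M {1..m} (\<lambda>_. borel))"
    using meas by measurable
  have restr: "G (\<lambda>i\<in>{1..m}. X (\<sigma> i) \<omega>) = G ((\<lambda>i. X i \<omega>) \<circ> \<sigma>)" for \<sigma> \<omega>
    using local[of "(\<lambda>i. X i \<omega>) \<circ> \<sigma>"] by (simp add: o_def)
  have eq: "(\<integral>\<^sup>+\<omega>. ennreal (G ((\<lambda>i. X i \<omega>) \<circ> \<sigma>)) \<partial>M) = (\<integral>\<^sup>+\<omega>. ennreal (G (\<lambda>i. X i \<omega>)) \<partial>M)"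
    if "\<sigma> \<in> ?P" for \<sigma>
    using exchangeable_nn_integral[OF ex _ measG, of \<sigma>] that restr[of \<sigma>] restr[of id] by (simp add: o_def)
  have measX: "(\<lambda>\<omega>. ennreal (G ((\<lambda>i. X i \<omega>) \<circ> \<sigma>))) \<in> borel_measurable M" if "\<sigma> \<in> ?P" for \<sigma>
  proof -
    have "(\<lambda>\<omega>. \<lambda>i\<in>{1..m}. X (\<sigma> i) \<omega>) \<in> measurable M (Pi\<^sub>M {1..m} (\<lambda>_. borel))"
      using X permutes_in_image[of \<sigma> "{1..m}"] that by (intro measurable_restrict) blast
    from measurable_compose[OF this measG] show ?thesis by (simp only: restr)
  qed
  have "fact m * (\<integral>\<^sup>+\<omega>. ennreal (G (\<lambda>i. X i \<omega>)) \<partial>M)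
      = (\<Sum>\<sigma>\<in>?P. \<integral>\<^sup>+\<omega>. ennreal (G ((\<lambda>i. X i \<omega>) \<circ> \<sigma>)) \<partial>M)"
    using card_permutations[of "{1..m}" m] by (simp add: eq)
  also have "\<dots> = (\<integral>\<^sup>+\<omega>. (\<Sum>\<sigma>\<in>?P. ennreal (G ((\<lambda>i. X i \<omega>) \<circ> \<sigma>))) \<partial>M)"
    using measX by (rule nn_integral_sum[symmetric])
  also have "\<dots> = (\<integral>\<^sup>+\<omega>. ennreal (perm_sum {1..m} (\<lambda>i. X i \<omega>) G) \<partial>M)"
  proof (rule nn_integral_cong_AE)
    show "AE \<omega> in M. (\<Sum>\<sigma>\<in>?P. ennreal (G ((\<lambda>i. X i \<omega>) \<circ> \<sigma>)))
        = ennreal (perm_sum {1..m} (\<lambda>i. X i \<omega>) G)"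
      using nonneg
    proof eventually_elim
      case (elim \<omega>)
      have "0 \<le> G ((\<lambda>i. X i \<omega>) \<circ> \<sigma>)" if "\<sigma> \<in> ?P" for \<sigma>
        using elim permutes_in_image[of \<sigma> "{1..m}"] that by (intro G) auto
      then show ?case unfolding perm_sum_def by (rule sum_ennreal)
    qed
  qed
  finally show ?thesis .
qed

text \<open>Both integrals are multiplied by \<open>fact m\<close> and compared through
  \<open>perm_sum\<close>. The factor cancels in \<open>ennreal\<close> because it is neither zero
  nor infinite.\<close>

lemma exchangeable_nn_integral_mono:
  fixes G H :: "(nat \<Rightarrow> real) \<Rightarrow> real"
  assumes ex: "exchangeable M m X"
    and nonneg: "AE \<omega> in M. \<forall>i\<in>{1..m}. X i \<omega> \<ge> 0"
    and meas: "G \<in> borel_measurable (Pi\<^sub>M {1..m} (\<lambda>_. borel))" "H \<in> borel_measurable (Pi\<^sub>M {1..m} (\<lambda>_. borel))"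
    and local: "\<And>x. G (restrict x {1..m}) = G x" "\<And>x. H (restrict x {1..m}) = H x"
    and G: "\<And>x. (\<forall>i\<in>{1..m}. 0 \<le> x i) \<Longrightarrow> 0 \<le> G x"
    and H: "\<And>x. (\<forall>i\<in>{1..m}. 0 \<le> x i) \<Longrightarrow> 0 \<le> H x"
    and le: "\<And>x. (\<forall>i\<in>{1..m}. 0 \<le> x i) \<Longrightarrow> perm_sum {1..m} x G \<le> perm_sum {1..m} x H"
  shows "(\<integral>\<^sup>+\<omega>. ennreal (G (\<lambda>i. X i \<omega>)) \<partial>M) \<le> (\<integral>\<^sup>+\<omega>. ennreal (H (\<lambda>i. X i \<omega>)) \<partial>M)"
proof -
  have "(\<integral>\<^sup>+\<omega>. ennreal (perm_sum {1..m} (\<lambda>i. X i \<omega>) G) \<partial>M)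
      \<le> (\<integral>\<^sup>+\<omega>. ennreal (perm_sum {1..m} (\<lambda>i. X i \<omega>) H) \<partial>M)"
  proof (rule nn_integral_mono_AE)
    show "AE \<omega> in M. ennreal (perm_sum {1..m} (\<lambda>i. X i \<omega>) G) \<le> ennreal (perm_sum {1..m} (\<lambda>i. X i \<omega>) H)"
      using nonneg by eventually_elim (intro ennreal_leI le)
  qed
  then have "fact m * (\<integral>\<^sup>+\<omega>. ennreal (G (\<lambda>i. X i \<omega>)) \<partial>M) \<le> fact m * (\<integral>\<^sup>+\<omega>. ennreal (H (\<lambda>i. X i \<omega>)) \<partial>M)"
    by (simp add: exchangeable_nn_integral_perm_sum[OF ex nonneg meas(1) local(1) G]
        exchangeable_nn_integral_perm_sum[OF ex nonneg meas(2) local(2) H])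
  moreover have "(fact m :: ennreal) = of_nat (fact m)" by simp
  ultimately show ?thesis
    by (metis ennreal_mult_le_mult_iff fact_nonzero of_nat_eq_0_iff ennreal_of_nat_eq_real_of_nat ennreal_neq_top)
qed

section \<open>Comparing expectations with values in the extended reals\<close>

text \<open>After the shift by \<open>K\<close> both variables are nonnegative almost everywhere. If
  \<open>g + K\<close> has finite integral, so has \<open>f + K\<close>, and the shift is subtracted
  again; otherwise the positive part of \<open>g\<close> has infinite integral, its negative part a
  finite one, and the right-hand side is \<open>\<infinity>\<close>.\<close>

lemma (in prob_space) ext_expectation_mono_below:
  assumes meas: "f \<in> borel_measurable M" "g \<in> borel_measurable M"
    and bd: "AE \<omega> in M. - K \<le> f \<omega>" "AE \<omega> in M. - K \<le> g \<omega>"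
    and le: "(\<integral>\<^sup>+\<omega>. ennreal (f \<omega> + K) \<partial>M) \<le> (\<integral>\<^sup>+\<omega>. ennreal (g \<omega> + K) \<partial>M)"
  shows "expectation_exists M f" "expectation_exists M g" "ext_expectation M f \<le> ext_expectation M g"
proof -
  have const: "(\<integral>\<^sup>+\<omega>. ennreal K \<partial>M) = ennreal K" by (simp add: emeasure_space_1)
  have neg: "(\<integral>\<^sup>+\<omega>. ennreal (- h \<omega>) \<partial>M) < \<infinity>" if "AE \<omega> in M. - K \<le> h \<omega>" for h
  proof -
    have "(\<integral>\<^sup>+\<omega>. ennreal (- h \<omega>) \<partial>M) \<le> (\<integral>\<^sup>+\<omega>. ennreal K \<partial>M)"
      using that by (intro nn_integral_mono_AE) (auto elim!: eventually_mono intro!: ennreal_leI)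
    then show ?thesis by (simp only: const) (simp add: order.strict_trans1)
  qed
  show "expectation_exists M f" "expectation_exists M g"
    using meas bd neg by (auto simp: expectation_exists_def)
  have int: "integrable M h" "ennreal (expectation h + K) = (\<integral>\<^sup>+\<omega>. ennreal (h \<omega> + K) \<partial>M)"
      "0 \<le> expectation h + K"
    if h: "h \<in> borel_measurable M" "AE \<omega> in M. - K \<le> h \<omega>" "(\<integral>\<^sup>+\<omega>. ennreal (h \<omega> + K) \<partial>M) < \<infinity>" for h
  proof -
    have nn: "AE \<omega> in M. 0 \<le> h \<omega> + K" using h(2) by eventually_elim simp
    have 1: "integrable M (\<lambda>\<omega>. h \<omega> + K)"
      using h nn by (intro integrableI_nonneg) auto
    from Bochner_Integration.integrable_diff[OF this integrable_const[of K]]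
    show 2: "integrable M h" by simp
    have "expectation (\<lambda>\<omega>. h \<omega> + K) = expectation h + K"
      using 2 by (simp add: prob_space)
    then show "ennreal (expectation h + K) = (\<integral>\<^sup>+\<omega>. ennreal (h \<omega> + K) \<partial>M)" "0 \<le> expectation h + K"
      using nn_integral_eq_integral[OF 1 nn] integral_nonneg_AE[OF nn] by simp_all
  qed
  show "ext_expectation M f \<le> ext_expectation M g"
  proof (cases "(\<integral>\<^sup>+\<omega>. ennreal (g \<omega> + K) \<partial>M) < \<infinity>")
    case True
    then have fin: "(\<integral>\<^sup>+\<omega>. ennreal (f \<omega> + K) \<partial>M) < \<infinity>" using le by (rule order.strict_trans1[rotated])
    have "ennreal (expectation f + K) \<le> ennreal (expectation g + K)"
      using le by (simp only: int(2)[OF meas(1) bd(1) fin] int(2)[OF meas(2) bd(2) True])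
    then have "expectation f \<le> expectation g"
      using int(3)[OF meas(2) bd(2) True] by (simp add: ennreal_le_iff)
    then show ?thesis
      using ext_expectation_integrable(2)[OF int(1)[OF meas(1) bd(1) fin]]
        ext_expectation_integrable(2)[OF int(1)[OF meas(2) bd(2) True]] by simp
  next
    case False
    then have "\<infinity> = (\<integral>\<^sup>+\<omega>. ennreal (g \<omega> + K) \<partial>M)" by (simp add: less_top[symmetric])
    also have "\<dots> \<le> (\<integral>\<^sup>+\<omega>. ennreal (g \<omega>) + ennreal K \<partial>M)"
      by (intro nn_integral_mono) (auto simp: ennreal_plus_if intro!: ennreal_leI)
    also have "\<dots> = (\<integral>\<^sup>+\<omega>. ennreal (g \<omega>) \<partial>M) + ennreal K"
      using meas(2) by (subst nn_integral_add) (auto simp: const simp del: nn_integral_const)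
    finally have "(\<integral>\<^sup>+\<omega>. ennreal (g \<omega>) \<partial>M) = \<infinity>"
      by (simp add: top_unique)
    moreover obtain r where "(\<integral>\<^sup>+\<omega>. ennreal (- g \<omega>) \<partial>M) = ennreal r" "0 \<le> r"
      using neg[OF bd(2)] by (cases "\<integral>\<^sup>+\<omega>. ennreal (- g \<omega>) \<partial>M") auto
    ultimately show ?thesis by (simp add: ext_expectation_def enn2ereal_ennreal)
  qed
qed

text \<open>The positive and the negative part change places. Existence excludes that both have
  infinite integral, a case in which the \<open>ereal\<close> difference would not change
  sign.\<close>

lemma ext_expectation_uminus:
  assumes "expectation_exists M f"
  shows "expectation_exists M (\<lambda>\<omega>. - f \<omega>)" "ext_expectation M (\<lambda>\<omega>. - f \<omega>) = - ext_expectation M f"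
proof -
  show "expectation_exists M (\<lambda>\<omega>. - f \<omega>)"
    using assms by (auto simp: expectation_exists_def)
  show "ext_expectation M (\<lambda>\<omega>. - f \<omega>) = - ext_expectation M f"
    using assms unfolding ext_expectation_def expectation_exists_def
    by (cases "\<integral>\<^sup>+\<omega>. ennreal (f \<omega>) \<partial>M"; cases "\<integral>\<^sup>+\<omega>. ennreal (- f \<omega>) \<partial>M")
      (auto simp: enn2ereal_ennreal)
qed

lemma (in prob_space) ext_expectation_mono_above:
  assumes meas: "f \<in> borel_measurable M" "g \<in> borel_measurable M"
    and bd: "AE \<omega> in M. f \<omega> \<le> K" "AE \<omega> in M. g \<omega> \<le> K"
    and le: "(\<integral>\<^sup>+\<omega>. ennreal (K - g \<omega>) \<partial>M) \<le> (\<integral>\<^sup>+\<omega>. ennreal (K - f \<omega>) \<partial>M)"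
  shows "expectation_exists M f" "expectation_exists M g" "ext_expectation M f \<le> ext_expectation M g"
proof -
  have *: "expectation_exists M (\<lambda>\<omega>. - g \<omega>)" "expectation_exists M (\<lambda>\<omega>. - f \<omega>)"
    "ext_expectation M (\<lambda>\<omega>. - g \<omega>) \<le> ext_expectation M (\<lambda>\<omega>. - f \<omega>)"
    using ext_expectation_mono_below[of "\<lambda>\<omega>. - g \<omega>" "\<lambda>\<omega>. - f \<omega>" K] meas bd le by simp_all
  show "expectation_exists M f" "expectation_exists M g"
    using ext_expectation_uminus(1)[OF *(1)] ext_expectation_uminus(1)[OF *(2)] by simp_all
  then show "ext_expectation M f \<le> ext_expectation M g"
    using *(3) by (simp add: ext_expectation_uminus(2))
qed

text \<open>A nonnegative subgradient at some \<open>y \<ge> 0\<close> gives a supporting line that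
  is bounded below on the half line. If all subgradients there are negative, the supporting line at
  \<open>z\<close>, evaluated at 0, shows \<open>\<phi> z \<le> \<phi> 0\<close>.\<close>

lemma convex_on_bounded_half_line:
  fixes \<phi> :: "real \<Rightarrow> real"
  assumes "convex_on UNIV \<phi>"
  obtains (below) K where "\<And>z. 0 \<le> z \<Longrightarrow> - K \<le> \<phi> z"
    | (above) K where "\<And>z. 0 \<le> z \<Longrightarrow> \<phi> z \<le> K"
proof -
  obtain \<psi> where \<psi>: "\<And>x y. \<phi> x + \<psi> x * (y - x) \<le> \<phi> y"
    using convex_on_subgradient[OF assms] by blast
  show ?thesis
  proof (cases "\<exists>y\<ge>0. 0 \<le> \<psi> y")
    case True
    then obtain y where y: "0 \<le> y" "0 \<le> \<psi> y" by blast
    have "- (\<psi> y * y - \<phi> y) \<le> \<phi> z" if "0 \<le> z" for z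
      using \<psi>[of y z] mult_nonneg_nonneg[OF y(2) that] by (simp add: algebra_simps)
    then show ?thesis by (rule below)
  next
    case False
    have "\<phi> z \<le> \<phi> 0" if "0 \<le> z" for z
    proof -
      have "\<psi> z * z \<le> 0" using False that by (intro mult_nonpos_nonneg) auto
      then show ?thesis using \<psi>[of z 0] by simp
    qed
    then show ?thesis by (rule above)
  qed
qed

section \<open>Block products as functions of the vector, and the theorem\<close>

lemma block_prod_eq_block_means:
  "block_prod n c X \<omega> = block_means {1..n} (consec_block c) (\<lambda>i. X i \<omega>)"
  unfolding block_prod_def block_means_def
  by (intro prod.cong) (simp_all add: card_consec_block, simp add: consec_block_def)

lemma consec_block_subset:
  assumes "k \<in> {1..n}" "psum c n = m"
  shows "consec_block c k \<subseteq> {1..m}"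
  using UN_consec_block[of c n] assms by blast

lemma borel_measurable_block_means_consec:
  assumes "psum c n = m"
  shows "block_means {1..n} (consec_block c) \<in> borel_measurable (Pi\<^sub>M {1..m} (\<lambda>_. borel))"
proof -
  have "(\<lambda>y. y i) \<in> borel_measurable (Pi\<^sub>M {1..m} (\<lambda>_. borel :: real measure))"
    if "k \<in> {1..n}" "i \<in> consec_block c k" for i k
    using consec_block_subset[OF that(1) assms] that(2) by (intro measurable_component_singleton) blast
  then have "(\<lambda>y. \<Prod>k\<in>{1..n}. (\<Sum>i\<in>consec_block c k. y i) / real (card (consec_block c k)))
      \<in> borel_measurable (Pi\<^sub>M {1..m} (\<lambda>_. borel))"
    by (intro borel_measurable_prod borel_measurable_divide borel_measurable_sum borel_measurable_const)
  then show ?thesis by (simp add: block_means_def[abs_def])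
qed

lemma block_means_consec_restrict:
  assumes "psum c n = m"
  shows "block_means {1..n} (consec_block c) (restrict y {1..m}) = block_means {1..n} (consec_block c) y"
proof -
  have "sum (restrict y {1..m}) (consec_block c k) = sum y (consec_block c k)" if "k \<in> {1..n}" for k
    using consec_block_subset[OF that assms] by (intro sum.cong) auto
  then show ?thesis unfolding block_means_def by (intro prod.cong) auto
qed

lemma block_means_consec_nonneg:
  assumes "psum c n = m" "\<forall>i\<in>{1..m}. 0 \<le> y i"
  shows "0 \<le> block_means {1..n} (consec_block c) y"
proof -
  have "0 \<le> sum y (consec_block c k)" if "k \<in> {1..n}" for k
    using consec_block_subset[OF that assms(1)] assms(2) by (intro sum_nonneg) blast
  then show ?thesis
    unfolding block_means_def by (intro prod_nonneg divide_nonneg_nonneg ballI) auto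
qed

theorem corollary2:
  fixes M :: "'w measure" and m n :: nat and X :: "nat \<Rightarrow> 'w \<Rightarrow> real" and a b :: "nat \<Rightarrow> nat"
  assumes "prob_space M"
    and "m \<ge> 1" and "n \<ge> 1"
    and "exchangeable M m X"
    and "\<And>i. i \<in> {1..m} \<Longrightarrow> AE \<omega> in M. X i \<omega> \<ge> 0"
    and "partition_of m n a" and "partition_of m n b"
    and "majorized_by n (\<lambda>j. real (a j)) (\<lambda>j. real (b j))"
  shows "conv_order M (block_prod n a X) (block_prod n b X)"
  unfolding conv_order_def
proof (intro allI impI)
  fix \<phi> :: "real \<Rightarrow> real" assume \<phi>: "convex_on UNIV \<phi>"
  interpret prob_space M by fact
  define F where "F c = block_means {1..n} (consec_block c)" for c
  define Y where "Y c \<omega> = F c (\<lambda>i. X i \<omega>)" for c \<omega>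
  have Y: "block_prod n c X = Y c" for c
    by (intro ext) (simp add: Y_def F_def block_prod_eq_block_means)
  have psum: "psum a n = m" "psum b n = m"
    using assms(6,7) by (auto simp: partition_of_def psum_def)
  have nonneg: "AE \<omega> in M. \<forall>i\<in>{1..m}. X i \<omega> \<ge> 0"
    using assms(5) by (intro AE_finite_allI) auto
  have X: "(\<lambda>\<omega>. \<lambda>i\<in>{1..m}. X i \<omega>) \<in> measurable M (Pi\<^sub>M {1..m} (\<lambda>_. borel))"
    using assms(4) by (intro measurable_restrict) (simp add: exchangeable_def)
  have "continuous_on UNIV \<phi>" using \<phi> by (intro convex_on_continuous) auto
  then have meas_\<phi>: "\<phi> \<in> borel_measurable borel" by (rule borel_measurable_continuous_onI)
  \<comment> \<open>Measurability of \<open>F c\<close> is known only on restricted vectors; since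
    \<open>F c\<close> ignores the restriction, it carries over to \<open>Y c\<close>.\<close>
  have local: "F c (restrict x {1..m}) = F c x" if "psum c n = m" for c x
    unfolding F_def by (rule block_means_consec_restrict[OF that])
  have F: "(\<lambda>x. \<phi> (F c x)) \<in> borel_measurable (Pi\<^sub>M {1..m} (\<lambda>_. borel))" if "psum c n = m" for c
    unfolding F_def by (rule measurable_compose[OF borel_measurable_block_means_consec[OF that] meas_\<phi>])
  have F_nonneg: "0 \<le> F c x" if "psum c n = m" "\<forall>i\<in>{1..m}. 0 \<le> x i" for c x
    unfolding F_def by (rule block_means_consec_nonneg[OF that])
  have meas: "(\<lambda>\<omega>. \<phi> (Y c \<omega>)) \<in> borel_measurable M" if "psum c n = m" for c
    using measurable_compose[OF X F[OF that]] local[OF that] by (simp add: Y_def)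
  have Y_nonneg: "AE \<omega> in M. 0 \<le> Y c \<omega>" if "psum c n = m" for c
    using nonneg unfolding Y_def by eventually_elim (rule F_nonneg[OF that])
  have core: "perm_sum {1..m} x (\<lambda>y. \<phi> (F a y)) \<le> perm_sum {1..m} x (\<lambda>y. \<phi> (F b y))"
    if "\<forall>i\<in>{1..m}. 0 \<le> x i" for x
    unfolding F_def using that assms(6-8) by (intro perm_sum_majorization \<phi>) auto
  show "expectation_exists M (\<lambda>\<omega>. \<phi> (block_prod n a X \<omega>)) \<and>
        expectation_exists M (\<lambda>\<omega>. \<phi> (block_prod n b X \<omega>)) \<and>
        ext_expectation M (\<lambda>\<omega>. \<phi> (block_prod n a X \<omega>)) \<le> ext_expectation M (\<lambda>\<omega>. \<phi> (block_prod n b X \<omega>))"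
    using \<phi>
  proof (cases rule: convex_on_bounded_half_line)
    \<comment> \<open>Here \<open>\<phi> + K\<close> is nonnegative on the half line, and the
      constant contributes equally to both permutation sums.\<close>
    case (below K)
    have bd: "AE \<omega> in M. - K \<le> \<phi> (Y c \<omega>)" if "psum c n = m" for c
      using Y_nonneg[OF that] by eventually_elim (rule below)
    have "(\<integral>\<^sup>+\<omega>. ennreal (\<phi> (F a (\<lambda>i. X i \<omega>)) + K) \<partial>M) \<le> (\<integral>\<^sup>+\<omega>. ennreal (\<phi> (F b (\<lambda>i. X i \<omega>)) + K) \<partial>M)"
    proof (rule exchangeable_nn_integral_mono[OF assms(4) nonneg])
      fix x :: "nat \<Rightarrow> real" assume x: "\<forall>i\<in>{1..m}. 0 \<le> x i"
      show "0 \<le> \<phi> (F a x) + K" "0 \<le> \<phi> (F b x) + K"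
        using below[OF F_nonneg[OF psum(1) x]] below[OF F_nonneg[OF psum(2) x]] by linarith+
      show "perm_sum {1..m} x (\<lambda>y. \<phi> (F a y) + K) \<le> perm_sum {1..m} x (\<lambda>y. \<phi> (F b y) + K)"
        using core[OF x] unfolding perm_sum_add by linarith
    qed ((intro borel_measurable_add borel_measurable_diff borel_measurable_const F psum | simp only: local psum)+)
    then show ?thesis
      unfolding Y using ext_expectation_mono_below[OF meas meas bd bd] psum by (simp add: Y_def)
  next
    \<comment> \<open>Here \<open>K - \<phi>\<close> is nonnegative on the half line, and
      \<open>a\<close> and \<open>b\<close> exchange roles in the comparison of integrals.\<close>
    case (above K)
    have bd: "AE \<omega> in M. \<phi> (Y c \<omega>) \<le> K" if "psum c n = m" for c
      using Y_nonneg[OF that] by eventually_elim (rule above)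
    have "(\<integral>\<^sup>+\<omega>. ennreal (K - \<phi> (F b (\<lambda>i. X i \<omega>))) \<partial>M) \<le> (\<integral>\<^sup>+\<omega>. ennreal (K - \<phi> (F a (\<lambda>i. X i \<omega>))) \<partial>M)"
    proof (rule exchangeable_nn_integral_mono[OF assms(4) nonneg])
      fix x :: "nat \<Rightarrow> real" assume x: "\<forall>i\<in>{1..m}. 0 \<le> x i"
      show "0 \<le> K - \<phi> (F a x)" "0 \<le> K - \<phi> (F b x)"
        using above[OF F_nonneg[OF psum(1) x]] above[OF F_nonneg[OF psum(2) x]] by linarith+
      show "perm_sum {1..m} x (\<lambda>y. K - \<phi> (F b y)) \<le> perm_sum {1..m} x (\<lambda>y. K - \<phi> (F a y))"
        using core[OF x] unfolding perm_sum_def sum_subtractf by linarith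
    qed ((intro borel_measurable_add borel_measurable_diff borel_measurable_const F psum | simp only: local psum)+)
    then show ?thesis
      unfolding Y using ext_expectation_mono_above[OF meas meas bd bd] psum by (simp add: Y_def)
  qed
qed

end
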